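(* For two agents, there exists a polynomial-time algorithm that solves ExistsUMandPROP1, i.e., that, given an allocation instance $(N,O,u)$ with $|N|=2$, decides whether there exists an allocation that is both utilitarian-maximal (UM) and proportional up to one item (PROP1).
   Context: An allocation instance is a tuple $(N,O,u)$ where $N=\{1,\dots,n\}$ is a set of agents, $O=\{o_1,\dots,o_m\}$ is a set of items, and $u$ specifies for each agent $i\in N$ a utility function $u_i:O\to\mathbb{R}_{\ge 0}$ (for computational purposes, non-negative rational numbers encoded in binary). Utilities are additive: $u_i(O')=\sum_{o\in O'}u_i(o)$ for every $O'\subseteq O$. An allocation is a function $p:N\to 2^O$ with $\bigcup_{i\in N}p(i)=O$ and $p(i)\cap p(j)=\emptyset$ for all $i\ne j$. An allocation $p$ is utilitarian-maximal (UM) if it maximizes $\sum_{i\in N}u_i(q(i))$ over all allocations $q$. An allocation $p$ is proportional up to one item (PROP1) if for each agent $i\in N$ there exists a subset $O'\subseteq O\setminus p(i)$ with $|O'|\le 1$ such that $u_i(p(i)\cup O')\ge u_i(O)/n$. *)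

theory Defs
  imports
    Complex_Main
    "HOL-Library.Log_Nat"
    "HOL-Computational_Algebra.Polynomial"
begin

section \<open>Allocation instances\<close>

text \<open>
  Agents are \<open>{1..n}\<close>, items are \<open>{1..m}\<close>, and \<open>u i j\<close> is agent \<open>i\<close>'s utility for item \<open>j\<close>.
  Values of \<open>u\<close> and of allocations outside these ranges are irrelevant.  The notions are
  polymorphic so that they apply to real utilities as well as to the rational ones that
  form the input of an algorithm.
\<close>

definition agents :: "nat \<Rightarrow> nat set" where
  "agents n = {1..n}"

definition items :: "nat \<Rightarrow> nat set" where
  "items m = {1..m}"

definition allocation_instance ::
    "nat \<Rightarrow> nat \<Rightarrow> (nat \<Rightarrow> nat \<Rightarrow> 'a::linordered_field) \<Rightarrow> bool" where
  "allocation_instance n m u \<longleftrightarrow> n \<ge> 1 \<and> (\<forall>i\<in>agents n. \<forall>j\<in>items m. 0 \<le> u i j)"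

definition utility :: "(nat \<Rightarrow> nat \<Rightarrow> 'a::linordered_field) \<Rightarrow> nat \<Rightarrow> nat set \<Rightarrow> 'a" where
  "utility u i S = (\<Sum>j\<in>S. u i j)"

definition allocation :: "nat \<Rightarrow> nat \<Rightarrow> (nat \<Rightarrow> nat set) \<Rightarrow> bool" where
  "allocation n m p \<longleftrightarrow>
     (\<Union>i\<in>agents n. p i) = items m \<and>
     (\<forall>i\<in>agents n. \<forall>j\<in>agents n. i \<noteq> j \<longrightarrow> p i \<inter> p j = {})"

definition utilitarian_maximal ::
    "nat \<Rightarrow> nat \<Rightarrow> (nat \<Rightarrow> nat \<Rightarrow> 'a::linordered_field) \<Rightarrow> (nat \<Rightarrow> nat set) \<Rightarrow> bool" where
  "utilitarian_maximal n m u p \<longleftrightarrow>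
     allocation n m p \<and>
     (\<forall>q. allocation n m q \<longrightarrow>
        (\<Sum>i\<in>agents n. utility u i (q i)) \<le> (\<Sum>i\<in>agents n. utility u i (p i)))"

definition PROP1 ::
    "nat \<Rightarrow> nat \<Rightarrow> (nat \<Rightarrow> nat \<Rightarrow> 'a::linordered_field) \<Rightarrow> (nat \<Rightarrow> nat set) \<Rightarrow> bool" where
  "PROP1 n m u p \<longleftrightarrow>
     (\<forall>i\<in>agents n. \<exists>S. S \<subseteq> items m - p i \<and> card S \<le> 1 \<and>
        utility u i (p i \<union> S) \<ge> utility u i (items m) / of_nat n)"

definition exists_UM_and_PROP1 ::
    "nat \<Rightarrow> nat \<Rightarrow> (nat \<Rightarrow> nat \<Rightarrow> 'a::linordered_field) \<Rightarrow> bool" where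
  "exists_UM_and_PROP1 n m u \<longleftrightarrow>
     (\<exists>p. allocation n m p \<and> utilitarian_maximal n m u p \<and> PROP1 n m u p)"


section \<open>Polynomial-time algorithms\<close>

text \<open>
  The model of computation is the random access machine of Aho, Hopcroft and Ullman
  (\<open>The Design and Analysis of Computer Algorithms\<close>, Chapter 1) under the logarithmic cost
  criterion, without its division instruction.  Every instruction is charged the number of
  bits of all integers and all register addresses it touches, so polynomial time on this
  machine coincides with polynomial time on multi-tape Turing machines.

  Registers hold integers and are initially 0; register 0 is the accumulator.  The input is
  read from a one-way tape of integers, and the output is a tape of integers.
\<close>

datatype operand =
    Imm int   \<comment> \<open>the constant itself\<close>
  | Reg nat   \<comment> \<open>the contents of the given register\<close>
  | Ind nat   \<comment> \<open>the contents of the register whose address is in the given register\<close>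

datatype instr =
    Load operand
  | Store operand
  | Add operand
  | Sub operand
  | Mult operand
  | Read operand
  | Write operand
  | Jump nat
  | JGtz nat
  | JZero nat
  | Halt

type_synonym program = "instr list"

record config =
  pc :: nat
  regs :: "nat \<Rightarrow> int"
  inp :: "int list"
  outp :: "int list"

definition initial :: "int list \<Rightarrow> config" where
  "initial xs = \<lparr>pc = 0, regs = (\<lambda>_. 0), inp = xs, outp = []\<rparr>"

text \<open>The length of the binary representation of \<open>\<bar>z\<bar>\<close>, where 0 is written with one digit.\<close>

definition int_len :: "int \<Rightarrow> nat" where
  "int_len z = max 1 (floorlog 2 (nat \<bar>z\<bar>))"

text \<open>
  The value of an operand paired with the cost of fetching it.  Here and below, \<open>None\<close> means
  that the machine is stuck (for instance because of a negative address).
\<close>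

fun fetch :: "(nat \<Rightarrow> int) \<Rightarrow> operand \<Rightarrow> (int \<times> nat) option" where
  "fetch r (Imm z) = Some (z, int_len z)"
| "fetch r (Reg i) = Some (r i, int_len (int i) + int_len (r i))"
| "fetch r (Ind i) =
     (if r i < 0 then None
      else Some (r (nat (r i)), int_len (int i) + int_len (r i) + int_len (r (nat (r i)))))"

text \<open>The register denoted by an operand that is used as a target, with the cost of addressing it.\<close>

fun target :: "(nat \<Rightarrow> int) \<Rightarrow> operand \<Rightarrow> (nat \<times> nat) option" where
  "target r (Imm z) = None"
| "target r (Reg i) = Some (i, int_len (int i))"
| "target r (Ind i) =
     (if r i < 0 then None else Some (nat (r i), int_len (int i) + int_len (r i)))"

definition arith ::
    "(int \<Rightarrow> int \<Rightarrow> int) \<Rightarrow> operand \<Rightarrow> config \<Rightarrow> (config \<times> nat) option" where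
  "arith f a c =
     (case fetch (regs c) a of
        None \<Rightarrow> None
      | Some (v, k) \<Rightarrow>
          Some (c\<lparr>pc := pc c + 1, regs := (regs c)(0 := f (regs c 0) v)\<rparr>,
                int_len (regs c 0) + k))"

text \<open>The successor configuration together with the cost of the instruction executed.\<close>

fun exec :: "instr \<Rightarrow> config \<Rightarrow> (config \<times> nat) option" where
  "exec (Load a) c =
     (case fetch (regs c) a of
        None \<Rightarrow> None
      | Some (v, k) \<Rightarrow> Some (c\<lparr>pc := pc c + 1, regs := (regs c)(0 := v)\<rparr>, k))"
| "exec (Store a) c =
     (case target (regs c) a of
        None \<Rightarrow> None
      | Some (i, k) \<Rightarrow>
          Some (c\<lparr>pc := pc c + 1, regs := (regs c)(i := regs c 0)\<rparr>, int_len (regs c 0) + k))"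
| "exec (Add a) c = arith (+) a c"
| "exec (Sub a) c = arith (-) a c"
| "exec (Mult a) c = arith (*) a c"
| "exec (Read a) c =
     (case (target (regs c) a, inp c) of
        (Some (i, k), x # xs) \<Rightarrow>
          Some (c\<lparr>pc := pc c + 1, regs := (regs c)(i := x), inp := xs\<rparr>, int_len x + k)
      | _ \<Rightarrow> None)"
| "exec (Write a) c =
     (case fetch (regs c) a of
        None \<Rightarrow> None
      | Some (v, k) \<Rightarrow> Some (c\<lparr>pc := pc c + 1, outp := outp c @ [v]\<rparr>, k))"
| "exec (Jump l) c = Some (c\<lparr>pc := l\<rparr>, 1)"
| "exec (JGtz l) c =
     Some (c\<lparr>pc := if regs c 0 > 0 then l else pc c + 1\<rparr>, int_len (regs c 0))"
| "exec (JZero l) c =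
     Some (c\<lparr>pc := if regs c 0 = 0 then l else pc c + 1\<rparr>, int_len (regs c 0))"
| "exec Halt c = None"

text \<open>
  \<open>halts_in P c t ys\<close>: started in configuration \<open>c\<close>, program \<open>P\<close> reaches a \<open>Halt\<close> instruction at
  total cost \<open>t\<close>, and then \<open>ys\<close> is on the output tape.  A machine that is stuck does not halt.
\<close>

inductive halts_in :: "program \<Rightarrow> config \<Rightarrow> nat \<Rightarrow> int list \<Rightarrow> bool" for P where
  halt: "pc c < length P \<Longrightarrow> P ! pc c = Halt \<Longrightarrow> halts_in P c 1 (outp c)"
| step: "pc c < length P \<Longrightarrow> exec (P ! pc c) c = Some (c', k) \<Longrightarrow> halts_in P c' t ys \<Longrightarrow>
         halts_in P c (k + t) ys"

definition input_size :: "int list \<Rightarrow> nat" where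
  "input_size xs = (\<Sum>x\<leftarrow>xs. int_len x)"

text \<open>
  A decision problem consists of a set \<open>D\<close> of instances, an encoding \<open>enc\<close> of instances and the
  question \<open>Q\<close>.  An algorithm answers 1 for yes and 0 for no; its running time is bounded by a
  polynomial in the number of bits of the encoded instance.
\<close>

definition decidable_in_polynomial_time ::
    "'i set \<Rightarrow> ('i \<Rightarrow> int list) \<Rightarrow> ('i \<Rightarrow> bool) \<Rightarrow> bool" where
  "decidable_in_polynomial_time D enc Q \<longleftrightarrow>
     (\<exists>(P :: program) (b :: nat poly). \<forall>x\<in>D. \<exists>t.
        halts_in P (initial (enc x)) t [if Q x then 1 else 0] \<and>
        t \<le> poly b (input_size (enc x)))"


section \<open>The computational problem\<close>

type_synonym rat_instance = "nat \<times> nat \<times> (nat \<Rightarrow> nat \<Rightarrow> rat)"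

text \<open>
  The numbers of agents and items, followed by the utility matrix item by item; every utility
  is given by numerator and denominator in lowest terms.
\<close>

definition encode :: "rat_instance \<Rightarrow> int list" where
  "encode = (\<lambda>(n, m, u).
     int n # int m #
     concat (map (\<lambda>j. concat (map (\<lambda>i. case quotient_of (u i j) of (a, b) \<Rightarrow> [a, b])
       [1..<Suc n])) [1..<Suc m]))"

definition instances_with_agents :: "nat \<Rightarrow> rat_instance set" where
  "instances_with_agents k = {(n, m, u). allocation_instance n m u \<and> n = k}"

definition ExistsUMandPROP1 :: "rat_instance \<Rightarrow> bool" where
  "ExistsUMandPROP1 = (\<lambda>(n, m, u). exists_UM_and_PROP1 n m u)"

end

(*
  Every utilitarian-maximal allocation gives each item to an agent who values it most, so only the
  ties are free. Each agent is best off when given all ties, so it is necessary that each agent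
  would be satisfied with all ties. This is also sufficient: give agent 1 the fewest ties that
  satisfy it; if there is at least one, agent 1 still has less than half of its total, and since
  items go to whoever values them most, agent 2 has more than half of its own total.

  Either condition is a comparison of v(kept) + 2 max v(lost) with v(lost), which one pass over
  the items decides. As the machine does not divide, sums are kept as unreduced fractions over the
  product of the denominators. The numerators and denominators so obtained have polynomial length.
*)
theory Submission
  imports Defs
begin

section \<open>Combinatorial criterion for two agents\<close>

section \<open>Two agents\<close>

text \<open>For two agents, \<open>satisfied (items m) (u i) (p i)\<close> is the clause of
  \<open>PROP1\<close> for agent \<open>i\<close>.\<close>

definition satisfied :: "nat set \<Rightarrow> (nat \<Rightarrow> 'a::linordered_field) \<Rightarrow> nat set \<Rightarrow> bool" where
  "satisfied I v T \<longleftrightarrow> (\<exists>S \<subseteq> I - T. card S \<le> 1 \<and> sum v I / 2 \<le> sum v (T \<union> S))"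

text \<open>For finite \<open>I\<close>, twice the margin over half of \<open>sum v I\<close> that
  \<open>I - L\<close> reaches with the best choice of at most one further item. The inserted 0
  stands for adding no item and keeps \<open>Max\<close> defined.\<close>

definition surplus :: "nat set \<Rightarrow> nat set \<Rightarrow> (nat \<Rightarrow> 'a::linordered_field) \<Rightarrow> 'a" where
  "surplus I L v = sum v (I - L) - sum v (I \<inter> L) + 2 * Max (insert 0 (v ` (I \<inter> L)))"

text \<open>The old extra item, unless it already lies in \<open>T'\<close>, still works:
  nonnegativity lets the sum grow from \<open>T \<union> S\<close> to
  \<open>T' \<union> (S - T')\<close>.\<close>

lemma satisfied_mono:
  assumes "satisfied I v T" "T \<subseteq> T'" "T' \<subseteq> I" "finite I" "\<And>i. i \<in> I \<Longrightarrow> 0 \<le> v i"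
  shows "satisfied I v T'"
proof -
  obtain S where S: "S \<subseteq> I - T" "card S \<le> 1" "sum v I / 2 \<le> sum v (T \<union> S)"
    using assms(1) by (auto simp: satisfied_def)
  have "finite S" "finite (T' \<union> (S - T'))"
    using S(1) assms(3,4) by (auto intro: finite_subset)
  moreover have "sum v (T \<union> S) \<le> sum v (T' \<union> (S - T'))"
    using S(1) assms calculation by (intro sum_mono2) auto
  moreover have "card (S - T') \<le> 1"
    using card_mono[of S "S - T'"] \<open>finite S\<close> S(2) by auto
  ultimately show ?thesis
    using S assms(3) unfolding satisfied_def by (intro exI[of _ "S - T'"]) auto
qed

lemma satisfied_if_half:
  "sum v I / 2 \<le> sum v T \<Longrightarrow> satisfied I v T"
  unfolding satisfied_def by (intro exI[of _ "{}"]) simp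

lemma satisfied_if_half_insert:
  assumes "i \<in> I" "sum v I / 2 \<le> sum v (insert i T)"
  shows "satisfied I v T"
proof (cases "i \<in> T")
  case True
  then show ?thesis
    using assms satisfied_if_half by (simp add: insert_absorb)
next
  case False
  then show ?thesis
    using assms unfolding satisfied_def by (intro exI[of _ "{i}"]) simp
qed

lemma satisfied_iff_surplus:
  assumes "finite I"
  shows "satisfied I v (I - L) \<longleftrightarrow> 0 \<le> surplus I L v"
proof -
  have split: "sum v I = sum v (I - L) + sum v (I \<inter> L)"
    using sum.Int_Diff[OF assms, of v L] by simp
  let ?M = "Max (insert 0 (v ` (I \<inter> L)))"
  have fin: "finite (insert 0 (v ` (I \<inter> L)))"
    using assms by simp
  show ?thesis
  proof
    assume "satisfied I v (I - L)"
    then obtain S where S: "S \<subseteq> I - (I - L)" "card S \<le> 1"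
      "sum v I / 2 \<le> sum v ((I - L) \<union> S)"
      by (auto simp: satisfied_def)
    \<comment> \<open>\<open>card S \<le> 1\<close> alone would admit infinite sets, whose
      \<open>card\<close> is 0; finiteness comes from \<open>I\<close>.\<close>
    have "S = {} \<or> (\<exists>i. S = {i})"
      using S(1,2) finite_subset[of S I] assms
      by (metis Diff_subset One_nat_def card_1_singletonE card_0_eq le_Suc_eq le_zero_eq subset_trans)
    then have "sum v S \<le> ?M"
    proof
      assume "\<exists>i. S = {i}"
      then obtain i where "S = {i}"
        by blast
      then show ?thesis
        using S(1) Max_ge[OF fin, of "v i"] by auto
    qed (use Max_ge[OF fin, of 0] in simp)
    moreover have "sum v ((I - L) \<union> S) = sum v (I - L) + sum v S"
      using S(1) assms by (intro sum.union_disjoint) (auto intro: finite_subset)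
    ultimately show "0 \<le> surplus I L v"
      using S(3) split by (simp add: surplus_def field_simps)
  next
    assume surplus: "0 \<le> surplus I L v"
    consider "?M = 0" | i where "i \<in> I \<inter> L" "?M = v i"
      using Max_in[OF fin] by auto
    then show "satisfied I v (I - L)"
    proof cases
      case 1
      then show ?thesis
        using surplus split by (intro satisfied_if_half) (simp add: surplus_def field_simps)
    next
      case 2
      then have "sum v (insert i (I - L)) = sum v (I - L) + ?M"
        using assms by simp
      then show ?thesis
        using surplus split 2(1)
        by (intro satisfied_if_half_insert[of i]) (simp_all add: surplus_def field_simps)
    qed
  qed
qed

text \<open>Ties are handed to the agent with utility \<open>v\<close> in order of index until that
  agent is satisfied. Either none is needed and \<open>sw\<close> applies, or the other agent is
  left with at least half.\<close>

lemma ties_split: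
  fixes v w :: "nat \<Rightarrow> 'a::linordered_field"
  assumes v: "\<And>i. i \<in> items m \<Longrightarrow> 0 \<le> v i" and w: "\<And>i. i \<in> items m \<Longrightarrow> 0 \<le> w i"
    and sv: "satisfied (items m) v (items m - {i. v i < w i})"
    and sw: "satisfied (items m) w (items m - {i. w i < v i})"
  shows "\<exists>T \<subseteq> items m. items m \<inter> {i. w i < v i} \<subseteq> T \<and> T \<inter> {i. v i < w i} = {} \<and>
           satisfied (items m) v T \<and> satisfied (items m) w (items m - T)"
proof -
  \<comment> \<open>Items are numbered from 1, so \<open>T 0\<close> contains no ties, while
    \<open>T m\<close> contains all of them.\<close>
  define T where "T k = {i \<in> items m. w i < v i \<or> w i = v i \<and> i \<le> k}" for k
  have fin: "finite (items m)" "finite (T k)" for k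
    by (auto simp: items_def T_def)
  have T_m: "T m = items m - {i. v i < w i}"
    by (auto simp: T_def items_def)
  define k where "k = (LEAST k. satisfied (items m) v (T k))"
  have k: "satisfied (items m) v (T k)"
    unfolding k_def by (rule LeastI[of _ m]) (use sv T_m in simp)
  have "satisfied (items m) w (items m - T k)"
  proof (cases k)
    case 0
    then have "items m - T k = items m - {i. w i < v i}"
      by (auto simp: T_def items_def)
    then show ?thesis
      using sw by simp
  next
    case (Suc j)
    then have j: "\<not> satisfied (items m) v (T j)"
      unfolding k_def by (intro not_less_Least) simp
    \<comment> \<open>Since \<open>T k\<close> exceeds \<open>T j\<close> by at most the item
      \<open>k\<close>, a \<open>T k\<close> worth half of the total would already make
      \<open>T j\<close> satisfied.\<close>
    have "T k = T j \<or> k \<in> items m \<and> T k = insert k (T j)"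
      using Suc by (auto simp: T_def le_Suc_eq)
    then have "sum v (T k) < sum v (items m) / 2"
      using j satisfied_if_half[of v "items m" "T j"]
        satisfied_if_half_insert[of k "items m" v "T j"]
      by (auto simp: not_le[symmetric])
    moreover have "sum v (items m) = sum v (T k) + sum v (items m - T k)"
      "sum w (items m) = sum w (T k) + sum w (items m - T k)"
      using sum.subset_diff[of "T k" "items m"] fin by (auto simp: T_def add.commute)
    \<comment> \<open>In total, w(T k) \<le> v(T k) < v(rest) \<le> w(rest); the middle step holds
      because \<open>T k\<close> is worth less than half to \<open>v\<close>.\<close>
    moreover have "sum w (T k) \<le> sum v (T k)" "sum v (items m - T k) \<le> sum w (items m - T k)"
      by (auto intro!: sum_mono simp: T_def)
    ultimately show ?thesis
      by (intro satisfied_if_half) (simp add: field_simps)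
  qed
  then show ?thesis
    using k by (intro exI[of _ "T k"]) (auto simp: T_def)
qed

section \<open>Utilitarian-maximal allocations of two agents\<close>

lemma allocation_2_iff:
  "allocation 2 m p \<longleftrightarrow> p 1 \<subseteq> items m \<and> p 2 = items m - p 1"
proof -
  have "agents 2 = {1, 2}"
    by (auto simp: agents_def)
  then show ?thesis
    by (auto simp: allocation_def)
qed

text \<open>Each item contributes at most the larger of its two values, so the bound is attained iff
  no single item falls short of its maximum.\<close>

lemma welfare_le:
  fixes v w :: "nat \<Rightarrow> 'a::linordered_field"
  assumes "finite I" "T \<subseteq> I"
  shows "sum v T + sum w (I - T) \<le> (\<Sum>i\<in>I. max (v i) (w i))"
    and "sum v T + sum w (I - T) = (\<Sum>i\<in>I. max (v i) (w i)) \<longleftrightarrow>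
           I \<inter> {i. w i < v i} \<subseteq> T \<and> T \<inter> {i. v i < w i} = {}"
proof -
  let ?f = "\<lambda>i. max (v i) (w i) - (if i \<in> T then v i else w i)"
  have nonneg: "0 \<le> ?f i" for i
    by auto
  have "sum v T + sum w (I - T) = (\<Sum>i\<in>I. if i \<in> T then v i else w i)"
    using assms sum.If_cases[of I "\<lambda>i. i \<in> T" v w]
    by (simp add: Int_absorb1 Diff_eq Int_absorb2)
  then have eq: "(\<Sum>i\<in>I. max (v i) (w i)) = sum v T + sum w (I - T) + sum ?f I"
    by (simp add: sum_subtractf)
  show "sum v T + sum w (I - T) \<le> (\<Sum>i\<in>I. max (v i) (w i))"
    using eq sum_nonneg[of I ?f] nonneg by simp
  have "sum v T + sum w (I - T) = (\<Sum>i\<in>I. max (v i) (w i)) \<longleftrightarrow> (\<forall>i\<in>I. ?f i = 0)"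
    using eq sum_nonneg_eq_0_iff[of I ?f] nonneg assms(1) by simp
  also have "\<dots> \<longleftrightarrow> (\<forall>i\<in>I. (w i < v i \<longrightarrow> i \<in> T) \<and> (i \<in> T \<longrightarrow> \<not> v i < w i))"
    by (intro ball_cong) (auto simp: max_def)
  also have "\<dots> \<longleftrightarrow> I \<inter> {i. w i < v i} \<subseteq> T \<and> T \<inter> {i. v i < w i} = {}"
    using assms(2) by blast
  finally show "sum v T + sum w (I - T) = (\<Sum>i\<in>I. max (v i) (w i)) \<longleftrightarrow>
    I \<inter> {i. w i < v i} \<subseteq> T \<and> T \<inter> {i. v i < w i} = {}" .
qed

lemma utilitarian_maximal_2_iff:
  "utilitarian_maximal 2 m u p \<longleftrightarrow>
     allocation 2 m p \<and> items m \<inter> {i. u 2 i < u 1 i} \<subseteq> p 1 \<and> p 1 \<inter> {i. u 1 i < u 2 i} = {}"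
proof -
  have agents: "agents 2 = {1, 2}" and fin: "finite (items m)"
    by (auto simp: agents_def items_def)
  let ?W = "\<Sum>i\<in>items m. max (u 1 i) (u 2 i)"
  let ?w = "\<lambda>p. \<Sum>i\<in>agents 2. utility u i (p i)"
  have w: "?w q = sum (u 1) (q 1) + sum (u 2) (items m - q 1)" if "allocation 2 m q" for q
    using that by (simp add: agents utility_def allocation_2_iff)
  have le: "?w q \<le> ?W" if "allocation 2 m q" for q
    using welfare_le(1)[OF fin, of "q 1" "u 1" "u 2"] that w by (simp add: allocation_2_iff)
  \<comment> \<open>Giving all ties to agent 1 shows that the bound \<open>?W\<close> is attained,
    so maximality means welfare exactly \<open>?W\<close>.\<close>
  define q where
    "q i = (if i = (1 :: nat) then items m - {i. u 1 i < u 2 i} else items m \<inter> {i. u 1 i < u 2 i})" for i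
  have q: "allocation 2 m q"
    by (auto simp: allocation_2_iff q_def)
  have "?w q = ?W"
    unfolding w[OF q] by (subst welfare_le(2)[OF fin]) (auto simp: q_def)
  then have "utilitarian_maximal 2 m u p \<longleftrightarrow> allocation 2 m p \<and> ?w p = ?W"
    unfolding utilitarian_maximal_def using le q by (metis order.antisym)
  also have "\<dots> \<longleftrightarrow> allocation 2 m p \<and>
      items m \<inter> {i. u 2 i < u 1 i} \<subseteq> p 1 \<and> p 1 \<inter> {i. u 1 i < u 2 i} = {}"
  proof (rule conj_cong[OF refl])
    assume p: "allocation 2 m p"
    then have "p 1 \<subseteq> items m"
      by (simp add: allocation_2_iff)
    from welfare_le(2)[OF fin this, of "u 1" "u 2"]
    show "?w p = ?W \<longleftrightarrow> items m \<inter> {i. u 2 i < u 1 i} \<subseteq> p 1 \<and> p 1 \<inter> {i. u 1 i < u 2 i} = {}"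
      by (simp only: w[OF p])
  qed
  finally show ?thesis .
qed

text \<open>Maximality confines each agent to the items the other does not value strictly more, so
  necessity is monotonicity; sufficiency is \<open>ties_split\<close>.\<close>

theorem exists_UM_and_PROP1_2_iff:
  assumes "allocation_instance 2 m u"
  shows "exists_UM_and_PROP1 2 m u \<longleftrightarrow>
    0 \<le> surplus (items m) {i. u 1 i < u 2 i} (u 1) \<and>
    0 \<le> surplus (items m) {i. u 2 i < u 1 i} (u 2)"
proof -
  have agents: "agents 2 = {1, 2}" and fin: "finite (items m)"
    by (auto simp: agents_def items_def)
  have nonneg: "0 \<le> u 1 i" "0 \<le> u 2 i" if "i \<in> items m" for i
    using assms that by (auto simp: allocation_instance_def agents)
  have PROP1: "PROP1 2 m u p \<longleftrightarrow> satisfied (items m) (u 1) (p 1) \<and> satisfied (items m) (u 2) (p 2)" for p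
    by (simp add: PROP1_def agents satisfied_def utility_def)
  show ?thesis
    unfolding satisfied_iff_surplus[OF fin, symmetric]
  proof (intro iffI conjI)
    assume "exists_UM_and_PROP1 2 m u"
    then obtain p where p: "utilitarian_maximal 2 m u p" "PROP1 2 m u p"
      by (auto simp: exists_UM_and_PROP1_def)
    then have sub: "p 1 \<subseteq> items m - {i. u 1 i < u 2 i}" "p 2 \<subseteq> items m - {i. u 2 i < u 1 i}"
      unfolding utilitarian_maximal_2_iff allocation_2_iff by blast+
    have "satisfied (items m) (u 1) (p 1)" "satisfied (items m) (u 2) (p 2)"
      using p(2) by (simp_all add: PROP1)
    then show "satisfied (items m) (u 1) (items m - {i. u 1 i < u 2 i})"
      "satisfied (items m) (u 2) (items m - {i. u 2 i < u 1 i})"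
      using satisfied_mono[of "items m" "u 1", OF _ sub(1) Diff_subset fin nonneg(1)]
        satisfied_mono[of "items m" "u 2", OF _ sub(2) Diff_subset fin nonneg(2)] by simp_all
  next
    assume "satisfied (items m) (u 1) (items m - {i. u 1 i < u 2 i}) \<and>
      satisfied (items m) (u 2) (items m - {i. u 2 i < u 1 i})"
    then obtain T where T: "T \<subseteq> items m" "items m \<inter> {i. u 2 i < u 1 i} \<subseteq> T"
      "T \<inter> {i. u 1 i < u 2 i} = {}" "satisfied (items m) (u 1) T"
      "satisfied (items m) (u 2) (items m - T)"
      using ties_split[of m "u 1" "u 2"] nonneg by blast
    define p where "p i = (if i = (1 :: nat) then T else items m - T)" for i
    have "allocation 2 m p" "utilitarian_maximal 2 m u p" "PROP1 2 m u p"
      using T by (auto simp: p_def allocation_2_iff utilitarian_maximal_2_iff PROP1)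
    then show "exists_UM_and_PROP1 2 m u"
      by (auto simp: exists_UM_and_PROP1_def)
  qed
qed

section \<open>Bit lengths under arithmetic\<close>

section \<open>Cost of bounded runs\<close>

lemma int_len_ge_1: "1 \<le> int_len z"
  by (simp add: int_len_def)

lemma int_len_le_iff: "int_len z \<le> n \<longleftrightarrow> 1 \<le> n \<and> \<bar>z\<bar> < 2 ^ n"
proof -
  have "floorlog 2 (nat \<bar>z\<bar>) \<le> n \<longleftrightarrow> \<bar>z\<bar> < 2 ^ n"
  proof
    assume "floorlog 2 (nat \<bar>z\<bar>) \<le> n"
    then have "nat \<bar>z\<bar> < 2 ^ n"
      by (rule floorlog_leD) simp
    then show "\<bar>z\<bar> < 2 ^ n"
      by (simp add: nat_less_iff)
  next
    assume "\<bar>z\<bar> < 2 ^ n"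
    then have "nat \<bar>z\<bar> < 2 ^ n"
      by (simp add: nat_less_iff)
    then show "floorlog 2 (nat \<bar>z\<bar>) \<le> n"
      by (rule floorlog_leI) simp_all
  qed
  then show ?thesis
    by (simp add: int_len_def)
qed

lemma abs_less_int_len: "\<bar>z\<bar> < 2 ^ int_len z"
  using int_len_le_iff[of z "int_len z"] by simp

lemma int_len_mult: "int_len (x * y) \<le> int_len x + int_len y"
proof -
  have "\<bar>x * y\<bar> < 2 ^ (int_len x + int_len y)"
    unfolding abs_mult power_add
    by (intro mult_strict_mono' abs_less_int_len) simp_all
  then show ?thesis
    using int_len_ge_1[of x] by (simp add: int_len_le_iff)
qed

lemma int_len_add_sub:
  shows int_len_add: "int_len (x + y) \<le> int_len x + int_len y"
    and int_len_diff: "int_len (x - y) \<le> int_len x + int_len y"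
proof -
  have *: "(2 :: int) ^ int_len x + 2 ^ int_len y \<le> 2 ^ (int_len x + int_len y)"
  proof -
    have "(2 :: int) ^ 1 \<le> 2 ^ int_len x" "(2 :: int) ^ 1 \<le> 2 ^ int_len y"
      by (intro power_increasing int_len_ge_1; simp)+
    \<comment> \<open>For A and B the two powers, the right-hand side expands to A * B - A -
      B.\<close>
    then have "0 \<le> ((2 :: int) ^ int_len x - 2) * (2 ^ int_len y - 1) + (2 ^ int_len y - 2)"
      by simp
    then show ?thesis
      by (simp add: power_add algebra_simps)
  qed
  show "int_len (x + y) \<le> int_len x + int_len y" "int_len (x - y) \<le> int_len x + int_len y"
    using * abs_less_int_len[of x] abs_less_int_len[of y] int_len_ge_1[of x]
    by (simp_all add: int_len_le_iff)
qed

section \<open>Growth of numbers and cost along a run\<close>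

fun operand_within :: "nat \<Rightarrow> operand \<Rightarrow> bool" where
  "operand_within w (Imm z) \<longleftrightarrow> int_len z \<le> w"
| "operand_within w (Reg i) \<longleftrightarrow> int_len (int i) \<le> w"
| "operand_within w (Ind i) \<longleftrightarrow> int_len (int i) \<le> w"

text \<open>Jump targets are exempt because the cost model does not charge for them.\<close>

fun instr_within :: "nat \<Rightarrow> instr \<Rightarrow> bool" where
  "instr_within w (Load a) \<longleftrightarrow> operand_within w a"
| "instr_within w (Store a) \<longleftrightarrow> operand_within w a"
| "instr_within w (Add a) \<longleftrightarrow> operand_within w a"
| "instr_within w (Sub a) \<longleftrightarrow> operand_within w a"
| "instr_within w (Mult a) \<longleftrightarrow> operand_within w a"
| "instr_within w (Read a) \<longleftrightarrow> operand_within w a"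
| "instr_within w (Write a) \<longleftrightarrow> operand_within w a"
| "instr_within w _ \<longleftrightarrow> True"

text \<open>Unread input is included because \<open>Read\<close> copies it into a register.\<close>

definition config_within :: "nat \<Rightarrow> config \<Rightarrow> bool" where
  "config_within w c \<longleftrightarrow>
     (\<forall>r. int_len (regs c r) \<le> w) \<and> (\<forall>x\<in>set (inp c). int_len x \<le> w)"

lemma operand_within_mono: "operand_within w a \<Longrightarrow> w \<le> w' \<Longrightarrow> operand_within w' a"
  by (cases a) auto

lemma instr_within_mono: "instr_within w i \<Longrightarrow> w \<le> w' \<Longrightarrow> instr_within w' i"
  by (cases i) (auto intro: operand_within_mono)

lemma fetch_within:
  assumes "fetch r a = Some (v, k)" "operand_within w a" "\<And>i. int_len (r i) \<le> w"
  shows "int_len v \<le> w" "k \<le> 3 * w"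
proof -
  have "int_len v \<le> w \<and> k \<le> 3 * w"
  proof (cases a)
    case (Ind i)
    then show ?thesis
      using assms(1,2) assms(3)[of i] assms(3)[of "nat (r i)"] by (auto split: if_splits)
  next
    case (Reg i)
    then show ?thesis
      using assms(1,2) assms(3)[of i] by auto
  qed (use assms in auto)
  then show "int_len v \<le> w" "k \<le> 3 * w"
    by auto
qed

lemma target_within:
  assumes "target r a = Some (i, k)" "operand_within w a" "\<And>i. int_len (r i) \<le> w"
  shows "k \<le> 2 * w"
proof (cases a)
  case (Ind j)
  then show ?thesis
    using assms(1,2) assms(3)[of j] by (auto split: if_splits)
qed (use assms in auto)

lemma config_within_double: "config_within w c \<Longrightarrow> config_within (2 * w) c"
  by (auto simp: config_within_def intro: order_trans[of _ w "2 * w"])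

lemma arith_within:
  assumes "arith f a c = Some (c', k)" "operand_within w a" "config_within w c"
    and f: "\<And>x y. int_len (f x y) \<le> int_len x + int_len y"
  shows "k \<le> 4 * w \<and> config_within (2 * w) c'"
proof -
  obtain v l where v: "fetch (regs c) a = Some (v, l)"
    and c': "c' = c\<lparr>pc := pc c + 1, regs := (regs c)(0 := f (regs c 0) v)\<rparr>"
    and k: "k = int_len (regs c 0) + l"
    using assms(1) by (auto simp: arith_def split: option.splits)
  have w: "int_len (regs c i) \<le> w" for i
    using assms(3) by (simp add: config_within_def)
  have "int_len v \<le> w" "l \<le> 3 * w"
    using fetch_within[OF v assms(2) w] by auto
  moreover from this have "int_len (f (regs c 0) v) \<le> 2 * w"
    using f[of "regs c 0" v] w[of 0] by linarith
  ultimately show ?thesis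
    using w[of 0] config_within_double[OF assms(3)] c' k by (simp add: config_within_def)
qed

text \<open>At most three lengths are charged for the operand and one for the accumulator or input.
  Only arithmetic creates new numbers, no longer than both arguments together.\<close>

lemma exec_within:
  assumes "exec i c = Some (c', k)" "instr_within w i" "config_within w c"
  shows "k \<le> 4 * w \<and> config_within (2 * w) c'"
proof -
  have w: "int_len (regs c i) \<le> w" for i
    using assms(3) by (simp add: config_within_def)
  have w1: "1 \<le> w"
    using w[of 0] int_len_ge_1[of "regs c 0"] by simp
  have inp: "int_len x \<le> w" if "x \<in> set (inp c)" for x
    using assms(3) that by (simp add: config_within_def)
  have "k \<le> 4 * w \<and> config_within w c'" if "\<nexists>a. i \<in> {Add a, Sub a, Mult a}"
  proof (cases i)
    case (Load a)
    then obtain v where "fetch (regs c) a = Some (v, k)"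
      and "c' = c\<lparr>pc := pc c + 1, regs := (regs c)(0 := v)\<rparr>"
      using assms(1) by (auto split: option.splits)
    then show ?thesis
      using fetch_within[of "regs c" a v k w] w assms(2,3) Load by (auto simp: config_within_def)
  next
    case (Store a)
    then obtain j l where "target (regs c) a = Some (j, l)" "k = int_len (regs c 0) + l"
      and "c' = c\<lparr>pc := pc c + 1, regs := (regs c)(j := regs c 0)\<rparr>"
      using assms(1) by (auto split: option.splits)
    moreover from this have "k \<le> 4 * w"
      using target_within[of "regs c" a j l w] w assms(2) w[of 0] Store by fastforce
    ultimately show ?thesis
      using w assms(3) by (simp add: config_within_def)
  next
    case (Read a)
    then obtain j l x xs where "target (regs c) a = Some (j, l)" "k = int_len x + l"
      and "inp c = x # xs"
      and "c' = c\<lparr>pc := pc c + 1, regs := (regs c)(j := x), inp := xs\<rparr>"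
      using assms(1) by (auto split: option.splits list.splits)
    then show ?thesis
      using target_within[of "regs c" a j l w] inp[of x] w assms(2,3) Read
      by (auto simp: config_within_def)
  next
    case (Write a)
    then obtain v where "fetch (regs c) a = Some (v, k)"
      and "c' = c\<lparr>pc := pc c + 1, outp := outp c @ [v]\<rparr>"
      using assms(1) by (auto split: option.splits)
    then show ?thesis
      using fetch_within[of "regs c" a v k w] w assms(2,3) Write by (auto simp: config_within_def)
  next
    case (JGtz l)
    then show ?thesis
      using assms w[of 0] by (auto simp: config_within_def)
  next
    case (JZero l)
    then show ?thesis
      using assms w[of 0] by (auto simp: config_within_def)
  qed (use assms w1 that in \<open>auto simp: config_within_def\<close>)
  moreover have "k \<le> 4 * w \<and> config_within (2 * w) c'" if "i \<in> {Add a, Sub a, Mult a}" for a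
    using that assms arith_within int_len_add int_len_diff int_len_mult by fastforce
  ultimately show ?thesis
    using config_within_double by blast
qed

text \<open>Costs are dropped so that \<open>simp\<close> can execute code;
  \<open>halts_in_run\<close> recovers them. As \<open>Halt\<close> has no successor, runs end in
  front of it.\<close>

fun run :: "program \<Rightarrow> nat \<Rightarrow> config \<Rightarrow> config option" where
  "run P 0 c = Some c"
| "run P (Suc n) c =
     (if pc c < length P
      then case exec (P ! pc c) c of None \<Rightarrow> None | Some (c', k) \<Rightarrow> run P n c'
      else None)"

lemma run_add: "run P (n + n') c = Option.bind (run P n c) (run P n')"
  by (induction n arbitrary: c) (auto split: option.splits)

text \<open>
  Every instruction at most doubles the length of the longest number, which is where the factor
  \<open>2 ^ n\<close> comes from; it is a constant for the bounded number of steps of a loop iteration.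
\<close>

lemma halts_in_run:
  assumes "run P n c = Some c'" "halts_in P c' t ys"
    and "\<forall>i\<in>set P. instr_within w i" "config_within w c"
  shows "\<exists>t'. halts_in P c t' ys \<and> t' + 4 * w \<le> 4 * 2 ^ n * w + t"
  using assms
proof (induction n arbitrary: c w)
  case 0
  then show ?case
    by auto
next
  case (Suc n)
  obtain c1 k where pc: "pc c < length P" and ex: "exec (P ! pc c) c = Some (c1, k)"
    and run: "run P n c1 = Some c'"
    using Suc.prems(1) by (auto split: if_splits option.splits)
  have 1: "k \<le> 4 * w" "config_within (2 * w) c1"
    using exec_within[OF ex] Suc.prems(3,4) pc by auto
  have "\<forall>i\<in>set P. instr_within (2 * w) i"
    using Suc.prems(3) instr_within_mono by force
  \<comment> \<open>A geometric sum: this step costs at most 4 w, the next ones 8 w, 16 w, and so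
    on. Keeping \<open>4 * w\<close> on the left avoids subtraction on naturals.\<close>
  then obtain t' where "halts_in P c1 t' ys" "t' + 4 * (2 * w) \<le> 4 * 2 ^ n * (2 * w) + t"
    using Suc.IH[OF run Suc.prems(2) _ 1(2)] by auto
  then show ?case
    using 1(1) by (intro exI[of _ "k + t'"] conjI halts_in.step[OF pc ex]) simp_all
qed

section \<open>The machine program and its data layout\<close>

section \<open>The decision procedure\<close>

text \<open>
  Register 1 counts the remaining items, registers 2-5 hold the utilities of the current item,
  and registers 6-9 and 10-13 the tallies of the two agents.  Registers 14 and 15 are scratch;
  the agent loses the item iff register 14 is positive.  Code is not relocatable: \<open>l\<close> is the
  address at which it must be placed.
\<close>

definition agent_code :: "nat \<Rightarrow> nat \<Rightarrow> nat \<Rightarrow> nat \<Rightarrow> nat \<Rightarrow> nat \<Rightarrow> nat \<Rightarrow> program" where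
  "agent_code l N D P Q a b =
    [Load (Reg N), Mult (Reg b), Store (Reg N),
     Load (Reg D), Mult (Reg a), Store (Reg 15),
     Load (Reg 14), JGtz (l + 12),
     Load (Reg N), Add (Reg 15), Store (Reg N), Jump (l + 27),
     Load (Reg N), Sub (Reg 15), Store (Reg N),
     Load (Reg P), Mult (Reg b), Store (Reg 15),
     Load (Reg a), Mult (Reg Q), Sub (Reg 15),
     JGtz (l + 23), Jump (l + 27),
     Load (Reg a), Store (Reg P), Load (Reg b), Store (Reg Q),
     Load (Reg D), Mult (Reg b), Store (Reg D)]"

text \<open>Tests \<open>N * Q + 2 * P * D + 1 > 0\<close>, because \<open>JGtz\<close> is strict;
  \<open>Add (Reg 0)\<close> doubles the accumulator. On success control reaches
  \<open>l + 11\<close>, just behind the block.\<close>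

definition verdict_code :: "nat \<Rightarrow> nat \<Rightarrow> nat \<Rightarrow> nat \<Rightarrow> nat \<Rightarrow> program" where
  "verdict_code l N D P Q =
    [Load (Reg N), Mult (Reg Q), Store (Reg 14),
     Load (Reg P), Mult (Reg D), Add (Reg 0), Add (Reg 14), Add (Imm 1),
     JGtz (l + 11), Write (Imm 0), Halt]"

text \<open>The second \<open>Read\<close> overwrites the number of agents, known to be 2. Registers
  7, 9, 11 and 13 hold denominators and start at 1. The loop head is at 8 and its exit at
  94.\<close>

definition decider :: program where
  "decider =
    [Read (Reg 1), Read (Reg 1), Load (Imm 1), Store (Reg 7), Store (Reg 9), Store (Reg 11),
     Store (Reg 13), Load (Imm 0),
     Load (Reg 1), JZero 94, Sub (Imm 1), Store (Reg 1),
     Read (Reg 2), Read (Reg 3), Read (Reg 4), Read (Reg 5),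
     Load (Reg 2), Mult (Reg 5), Store (Reg 14), Load (Reg 4), Mult (Reg 3), Sub (Reg 14),
     Store (Reg 14)] @
    agent_code 23 6 7 8 9 2 3 @
    [Load (Imm 0), Sub (Reg 14), Store (Reg 14)] @
    agent_code 56 10 11 12 13 4 5 @
    [Load (Imm 0), Store (Reg 2), Store (Reg 3), Store (Reg 4), Store (Reg 5), Store (Reg 14),
     Store (Reg 15), Jump 8] @
    verdict_code 94 6 7 8 9 @
    verdict_code 105 10 11 12 13 @
    [Write (Imm 1), Halt]"

text \<open>A list padded with zeros, so that \<open>simp\<close> can execute stores as list
  updates.\<close>

definition bank :: "int list \<Rightarrow> nat \<Rightarrow> int" where
  "bank vs r = (if r < length vs then vs ! r else 0)"

lemma bank_upd: "i < length vs \<Longrightarrow> (bank vs)(i := v) = bank (vs[i := v])"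
  by (auto simp: bank_def fun_eq_iff)

definition state :: "nat \<Rightarrow> int list \<Rightarrow> int list \<Rightarrow> int list \<Rightarrow> config" where
  "state p vs xs ys = \<lparr>pc = p, regs = bank vs, inp = xs, outp = ys\<rparr>"

text \<open>
  \<open>x\<close> is positive if the agent loses the item of value \<open>a / b\<close>.  In a tally \<open>(N, D, P, Q)\<close>, the
  fraction \<open>N / D\<close> is the value of the items that can be kept minus that of the items lost, and
  \<open>P / Q\<close> is the largest value of a lost item.
\<close>

fun tally_item :: "int \<Rightarrow> int \<Rightarrow> int \<Rightarrow> int \<times> int \<times> int \<times> int \<Rightarrow> int \<times> int \<times> int \<times> int" where
  "tally_item x a b (N, D, P, Q) =
     (if x > 0
      then (N * b - D * a, D * b, if a * Q > P * b then (a, b) else (P, Q))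
      else (N * b + D * a, D * b, P, Q))"

text \<open>Every iteration clears the accumulator, item and scratch registers, so the counter, the
  tallies and the remaining input determine the configuration at the loop head.\<close>

fun loop_state :: "int \<Rightarrow> int \<times> int \<times> int \<times> int \<Rightarrow> int \<times> int \<times> int \<times> int \<Rightarrow> int list \<Rightarrow> config" where
  "loop_state j (N1, D1, P1, Q1) (N2, D2, P2, Q2) xs =
     state 8 [0, j, 0, 0, 0, 0, N1, D1, P1, Q1, N2, D2, P2, Q2, 0, 0] xs []"

lemma bank_nth: "i < length vs \<Longrightarrow> bank vs i = vs ! i"
  by (simp add: bank_def)

section \<open>Symbolic execution of the program\<close>

lemmas run_simps = decider_def agent_code_def verdict_code_def state_def arith_def bank_upd bank_nth

lemma length_decider: "length decider = 118"
  by (simp add: run_simps)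

lemma run_numeral: "run P (numeral k) c =
     (if pc c < length P
      then case exec (P ! pc c) c of None \<Rightarrow> None | Some (c', _) \<Rightarrow> run P (pred_numeral k) c'
      else None)"
  by (simp add: numeral_eq_Suc)

lemmas run_decider = run_numeral length_decider run_simps eval_nat_numeral(2,3)

lemma run_init:
  "run decider 8 (initial (n # m # xs)) = Some (loop_state m (0, 1, 0, 1) (0, 1, 0, 1) xs)"
proof -
  have *: "(\<lambda>_. 0) = bank (replicate 16 0)"
    by (auto simp: bank_def)
  show ?thesis
    by (simp add: initial_def * run_decider)
qed


text \<open>For positive denominators, the cross difference left in register 14 is positive iff
  agent 2 values the item strictly more.\<close>

lemma run_head:
  assumes "j > 0"
  shows "run decider 15 (loop_state j (N1, D1, P1, Q1) (N2, D2, P2, Q2) (a1 # b1 # a2 # b2 # xs)) =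
    Some (state 23 [a2 * b1 - a1 * b2, j - 1, a1, b1, a2, b2, N1, D1, P1, Q1, N2, D2, P2, Q2,
      a2 * b1 - a1 * b2, 0] xs [])"
  using assms by (simp add: run_decider)


text \<open>The three paths through the code take 15, 25 and 22 steps: item not lost, lost with a
  new maximum, lost without one.\<close>

lemma run_agent_1:
  assumes "tally_item x a1 b1 (N1, D1, P1, Q1) = (N', D', P', Q')"
  shows "\<exists>n\<le>25. run decider n (state 23 [r0, j, a1, b1, a2, b2, N1, D1, P1, Q1, N2, D2, P2, Q2, x, r15] xs ys) =
    Some (state 53 [D1 * b1, j, a1, b1, a2, b2, N', D', P', Q', N2, D2, P2, Q2, x, if x > 0 then P1 * b1 else D1 * a1] xs ys)"
proof -
  consider "\<not> x > 0" | "x > 0" "a1 * Q1 > P1 * b1" | "x > 0" "\<not> a1 * Q1 > P1 * b1"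
    by blast
  then show ?thesis
  proof cases
    case 1
    then show ?thesis
      using assms by (intro exI[of _ 15] conjI) (auto simp: run_decider)
  next
    case 2
    then show ?thesis
      using assms by (intro exI[of _ 25] conjI) (auto simp: run_decider)
  next
    case 3
    then show ?thesis
      using assms by (intro exI[of _ 22] conjI) (auto simp: run_decider)
  qed
qed

text \<open>The flipped sign serves agent 2; a tie leaves 0, so neither agent loses it.\<close>

lemma run_negate:
  "run decider 3 (state 53 [r0, j, a1, b1, a2, b2, N1, D1, P1, Q1, N2, D2, P2, Q2, x, r15] xs ys) =
    Some (state 56 [- x, j, a1, b1, a2, b2, N1, D1, P1, Q1, N2, D2, P2, Q2, - x, r15] xs ys)"
  by (simp add: run_decider)

lemma run_agent_2:
  assumes "tally_item x a2 b2 (N2, D2, P2, Q2) = (N', D', P', Q')"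
  shows "\<exists>n\<le>25. run decider n (state 56 [r0, j, a1, b1, a2, b2, N1, D1, P1, Q1, N2, D2, P2, Q2, x, r15] xs ys) =
    Some (state 86 [D2 * b2, j, a1, b1, a2, b2, N1, D1, P1, Q1, N', D', P', Q', x, if x > 0 then P2 * b2 else D2 * a2] xs ys)"
proof -
  consider "\<not> x > 0" | "x > 0" "a2 * Q2 > P2 * b2" | "x > 0" "\<not> a2 * Q2 > P2 * b2"
    by blast
  then show ?thesis
  proof cases
    case 1
    then show ?thesis
      using assms by (intro exI[of _ 15] conjI) (auto simp: run_decider)
  next
    case 2
    then show ?thesis
      using assms by (intro exI[of _ 25] conjI) (auto simp: run_decider)
  next
    case 3
    then show ?thesis
      using assms by (intro exI[of _ 22] conjI) (auto simp: run_decider)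
  qed
qed

lemma run_tail:
  "run decider 8 (state 86 [r0, j, a1, b1, a2, b2, N1, D1, P1, Q1, N2, D2, P2, Q2, x, r15] xs []) =
    Some (loop_state j (N1, D1, P1, Q1) (N2, D2, P2, Q2) xs)"
  by (simp add: run_decider)

text \<open>The bound is 76 = 15 + 25 + 3 + 25 + 8, for head, agent 1, negation, agent 2 and
  tail.\<close>

lemma run_item:
  assumes "j > 0"
  shows "\<exists>n\<le>76. run decider n (loop_state j t1 t2 (a1 # b1 # a2 # b2 # xs)) =
    Some (loop_state (j - 1) (tally_item (a2 * b1 - a1 * b2) a1 b1 t1)
      (tally_item (a1 * b2 - a2 * b1) a2 b2 t2) xs)"
proof -
  obtain N1 D1 P1 Q1 N2 D2 P2 Q2 where t: "t1 = (N1, D1, P1, Q1)" "t2 = (N2, D2, P2, Q2)"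
    by (metis prod_cases4)
  obtain N1' D1' P1' Q1' where t1: "tally_item (a2 * b1 - a1 * b2) a1 b1 t1 = (N1', D1', P1', Q1')"
    by (metis prod_cases4)
  obtain N2' D2' P2' Q2' where t2: "tally_item (a1 * b2 - a2 * b1) a2 b2 t2 = (N2', D2', P2', Q2')"
    by (metis prod_cases4)
  let ?x = "a2 * b1 - a1 * b2" and ?j = "j - 1"
  have t2': "tally_item (- ?x) a2 b2 (N2, D2, P2, Q2) = (N2', D2', P2', Q2')"
    using t2 unfolding t by (simp only: minus_diff_eq)
  obtain n1 where n1: "n1 \<le> 25"
    "run decider n1 (state 23 [?x, ?j, a1, b1, a2, b2, N1, D1, P1, Q1, N2, D2, P2, Q2, ?x, 0] xs []) =
       Some (state 53 [D1 * b1, ?j, a1, b1, a2, b2, N1', D1', P1', Q1', N2, D2, P2, Q2, ?x,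
         if ?x > 0 then P1 * b1 else D1 * a1] xs [])" (is "_ = Some (state _ [_, _, _, _, _, _, _, _, _, _, _, _, _, _, _, ?r] _ _)")
    using run_agent_1[OF t1[unfolded t]] by blast
  obtain n2 where n2: "n2 \<le> 25"
    "run decider n2 (state 56 [- ?x, ?j, a1, b1, a2, b2, N1', D1', P1', Q1', N2, D2, P2, Q2, - ?x, ?r] xs []) =
       Some (state 86 [D2 * b2, ?j, a1, b1, a2, b2, N1', D1', P1', Q1', N2', D2', P2', Q2', - ?x,
         if - ?x > 0 then P2 * b2 else D2 * a2] xs [])"
    using run_agent_2[OF t2'] by blast
  have "run decider (15 + (n1 + (3 + (n2 + 8)))) (loop_state j t1 t2 (a1 # b1 # a2 # b2 # xs)) =
    Some (loop_state ?j (N1', D1', P1', Q1') (N2', D2', P2', Q2') xs)"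
    unfolding t by (simp only: run_add run_head[OF assms] n1 run_negate n2 run_tail Option.bind.simps)
  then show ?thesis
    using n1(1) n2(1) unfolding t1 t2 by (intro exI[of _ "15 + (n1 + (3 + (n2 + 8)))"]) simp
qed

text \<open>The sign of \<open>N / D + 2 * (P / Q)\<close>, cleared of positive
  denominators.\<close>

fun tally_ok :: "int \<times> int \<times> int \<times> int \<Rightarrow> bool" where
  "tally_ok (N, D, P, Q) \<longleftrightarrow> 0 \<le> N * Q + 2 * (D * P)"

lemma run_verdict:
  "\<exists>n\<le>21. \<exists>c. run decider n (loop_state 0 t1 t2 xs) = Some c \<and>
     pc c < length decider \<and> decider ! pc c = Halt \<and>
     outp c = [if tally_ok t1 \<and> tally_ok t2 then 1 else 0]"
proof -
  obtain N1 D1 P1 Q1 N2 D2 P2 Q2 where t: "t1 = (N1, D1, P1, Q1)" "t2 = (N2, D2, P2, Q2)"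
    by (metis prod_cases4)
  consider "\<not> tally_ok t1" | "tally_ok t1" "\<not> tally_ok t2" | "tally_ok t1" "tally_ok t2"
    by blast
  then show ?thesis
  proof cases
    case 1
    then show ?thesis
      unfolding t by (intro exI[of _ 12] conjI) (auto simp: run_decider)
  next
    case 2
    then show ?thesis
      unfolding t by (intro exI[of _ 21] conjI) (auto simp: run_decider)
  next
    case 3
    then show ?thesis
      unfolding t by (intro exI[of _ 21] conjI) (auto simp: run_decider)
  qed
qed

section \<open>Tallies as exact fractions and their length\<close>

section \<open>Correctness and running time\<close>

text \<open>The loop on one tally: \<open>v\<close> is the agent's own utility and \<open>w\<close>
  that of the other agent.\<close>

primrec tally :: "(nat \<Rightarrow> rat) \<Rightarrow> (nat \<Rightarrow> rat) \<Rightarrow> nat \<Rightarrow> int \<times> int \<times> int \<times> int" where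
  "tally v w 0 = (0, 1, 0, 1)"
| "tally v w (Suc k) =
     (case (quotient_of (v (Suc k)), quotient_of (w (Suc k))) of
        ((a, b), (c, d)) \<Rightarrow> tally_item (c * b - a * d) a b (tally v w k))"

lemma items_0: "items 0 = {}"
  by (simp add: items_def)

lemma items_Suc: "items (Suc k) = insert (Suc k) (items k)"
  by (auto simp: items_def)

lemma finite_items: "finite (items k)"
  by (simp add: items_def)

text \<open>The loop invariant. Positivity of \<open>D\<close> and \<open>Q\<close> is carried along
  because it makes the integer comparisons agree with those of the fractions.\<close>

lemma tally_sound:
  fixes v w :: "nat \<Rightarrow> rat"
  defines "L \<equiv> {i. v i < w i}"
  assumes "tally v w k = (N, D, P, Q)"
  shows "D > 0 \<and> Q > 0 \<and>
    rat_of_int N / rat_of_int D = sum v (items k - L) - sum v (items k \<inter> L) \<and>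
    rat_of_int P / rat_of_int Q = Max (insert 0 (v ` (items k \<inter> L)))"
  using assms(2)
proof (induction k arbitrary: N D P Q)
  case 0
  then show ?case
    by (simp add: items_0)
next
  case (Suc k)
  obtain N0 D0 P0 Q0 where t0: "tally v w k = (N0, D0, P0, Q0)"
    by (metis prod_cases4)
  note IH = Suc.IH[OF t0]
  then have Q0: "Q0 > 0"
    by simp
  obtain a b where q: "quotient_of (v (Suc k)) = (a, b)"
    by fastforce
  obtain c d where q': "quotient_of (w (Suc k)) = (c, d)"
    by fastforce
  have ab: "b > 0" "v (Suc k) = rat_of_int a / rat_of_int b"
    using q quotient_of_denom_pos quotient_of_div by auto
  have cd: "d > 0" "w (Suc k) = rat_of_int c / rat_of_int d"
    using q' quotient_of_denom_pos quotient_of_div by auto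
  have x: "c * b - a * d > 0 \<longleftrightarrow> Suc k \<in> L"
  proof -
    have "Suc k \<in> L \<longleftrightarrow> rat_of_int (a * d) < rat_of_int (c * b)"
      unfolding L_def mem_Collect_eq ab(2) cd(2) using ab(1) cd(1)
      by (simp add: divide_less_eq less_divide_eq mult.commute mult.left_commute)
    then show ?thesis
      by (simp only: of_int_less_iff) simp
  qed
  have new: "Suc k \<notin> items k"
    by (simp add: items_def)
  show ?case
  proof (cases "Suc k \<in> L")
    case True
    then have upd: "N = N0 * b - D0 * a" "D = D0 * b" "(P, Q) = (if a * Q0 > P0 * b then (a, b) else (P0, Q0))"
      using Suc.prems x by (simp_all add: t0 q q' split: if_splits)
    have "a * Q0 > P0 * b \<longleftrightarrow> rat_of_int (P0 * b) < rat_of_int (a * Q0)"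
      by (simp only: of_int_less_iff)
    also have "\<dots> \<longleftrightarrow> rat_of_int P0 / rat_of_int Q0 < v (Suc k)"
      unfolding ab(2) using ab(1) Q0
      by (simp add: divide_less_eq less_divide_eq mult.commute mult.left_commute)
    finally have "rat_of_int P / rat_of_int Q = max (v (Suc k)) (rat_of_int P0 / rat_of_int Q0)"
      using upd(3) ab(2) by (auto simp: max_def split: if_splits)
    also have "\<dots> = Max (insert 0 (v ` (items (Suc k) \<inter> L)))"
      using True IH finite_items[of k] by (simp add: items_Suc insert_commute[of 0])
    finally have "rat_of_int P / rat_of_int Q = Max (insert 0 (v ` (items (Suc k) \<inter> L)))" .
    moreover have "rat_of_int N / rat_of_int D = rat_of_int N0 / rat_of_int D0 - v (Suc k)"
      using IH ab by (simp add: upd field_simps)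
    ultimately show ?thesis
      using True IH new finite_items[of k] ab upd by (auto simp: items_Suc split: if_splits)
  next
    case False
    then have upd: "N = N0 * b + D0 * a" "D = D0 * b" "P = P0" "Q = Q0"
      using Suc.prems x by (simp_all add: t0 q q' split: if_splits)
    have "rat_of_int N / rat_of_int D = rat_of_int N0 / rat_of_int D0 + v (Suc k)"
      using IH ab by (simp add: upd field_simps)
    then show ?thesis
      using False IH new finite_items[of k] ab upd by (simp add: items_Suc insert_Diff_if)
  qed
qed

lemma tally_ok_iff:
  "tally_ok (tally v w k) \<longleftrightarrow> 0 \<le> surplus (items k) {i. v i < w i} v"
proof -
  obtain N D P Q where t: "tally v w k = (N, D, P, Q)"
    by (metis prod_cases4)
  note sound = tally_sound[OF t]
  then have pos: "D > 0" "Q > 0"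
    by simp_all
  have "tally_ok (tally v w k) \<longleftrightarrow> rat_of_int 0 \<le> rat_of_int (N * Q + 2 * (D * P))"
    unfolding of_int_le_iff t by simp
  also have "\<dots> \<longleftrightarrow> 0 \<le> rat_of_int (N * Q + 2 * (D * P)) / (rat_of_int D * rat_of_int Q)"
    using pos by (simp add: pos_le_divide_eq)
  also have "rat_of_int (N * Q + 2 * (D * P)) / (rat_of_int D * rat_of_int Q) =
      rat_of_int N / rat_of_int D + 2 * (rat_of_int P / rat_of_int Q)"
    using pos by (simp add: field_simps)
  finally show ?thesis
    using sound by (simp add: surplus_def)
qed

text \<open>\<open>N\<close> gets a quadratic bound because every update adds a product containing
  \<open>D\<close>, whose length is itself linear. The summand 1 accommodates the initial 0 and 1
  when \<open>s\<close> is 0.\<close>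

fun tally_within :: "nat \<Rightarrow> int \<times> int \<times> int \<times> int \<Rightarrow> bool" where
  "tally_within s (N, D, P, Q) \<longleftrightarrow>
     int_len N \<le> (s + 1)\<^sup>2 \<and> int_len D \<le> s + 1 \<and> int_len P \<le> s + 1 \<and> int_len Q \<le> s + 1"

lemma tally_within_mono: "tally_within s t \<Longrightarrow> s \<le> s' \<Longrightarrow> tally_within s' t"
  by (cases t) (auto intro: order_trans power_mono[of "s + 1" "s' + 1" 2, simplified])

lemma tally_item_within:
  assumes "tally_within s t" "s + int_len a + int_len b \<le> s'"
  shows "tally_within s' (tally_item x a b t)"
proof -
  obtain N D P Q where t: "t = (N, D, P, Q)"
    by (metis prod_cases4)
  have "s + 1 \<le> s'"
    using assms(2) int_len_ge_1[of a] by simp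
  \<comment> \<open>From \<open>s\<close> to \<open>s'\<close> the square grows by at least
    \<open>s' + 1\<close>, which is room for the lengths of \<open>D\<close>, \<open>a\<close> and
    \<open>b\<close>.\<close>
  then have "(s + 1) * (s + 1) + (s' + 1) \<le> s' * (s' + 1) + (s' + 1)"
    by (intro add_right_mono mult_mono) auto
  then have "(s + 1)\<^sup>2 + (s' + 1) \<le> (s' + 1)\<^sup>2"
    by (simp add: power2_eq_square)
  then have "int_len N + int_len b + (int_len D + int_len a) \<le> (s' + 1)\<^sup>2"
    using assms unfolding t tally_within.simps by linarith
  moreover have "int_len (N * b + D * a) \<le> int_len N + int_len b + (int_len D + int_len a)"
    using int_len_add[of "N * b" "D * a"] int_len_mult[of N b] int_len_mult[of D a] by linarith
  moreover have "int_len (N * b - D * a) \<le> int_len N + int_len b + (int_len D + int_len a)"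
    using int_len_diff[of "N * b" "D * a"] int_len_mult[of N b] int_len_mult[of D a] by linarith
  ultimately show ?thesis
    using assms int_len_mult[of D b] by (auto simp: t)
qed

lemma int_len_bank:
  assumes "\<forall>v\<in>set vs. int_len v \<le> w" "int_len 0 \<le> w"
  shows "int_len (bank vs i) \<le> w"
  using assms by (simp add: bank_def)

lemma config_within_loop_state:
  assumes "tally_within s t1" "tally_within s t2" "int_len j \<le> s" "\<forall>x\<in>set xs. int_len x \<le> s"
  shows "config_within ((s + 1)\<^sup>2) (loop_state j t1 t2 xs)"
proof -
  obtain N1 D1 P1 Q1 N2 D2 P2 Q2 where t: "t1 = (N1, D1, P1, Q1)" "t2 = (N2, D2, P2, Q2)"
    by (metis prod_cases4)
  have le: "s + 1 \<le> (s + 1)\<^sup>2"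
    by (simp add: power2_eq_square)
  let ?vs = "[0, j, 0, 0, 0, 0, N1, D1, P1, Q1, N2, D2, P2, Q2, 0, 0]"
  have "int_len 0 \<le> (s + 1)\<^sup>2"
    using le by (simp add: int_len_le_iff)
  then have "int_len (bank ?vs i) \<le> (s + 1)\<^sup>2" for i
    using assms le unfolding t by (intro int_len_bank) simp_all
  moreover have "int_len x \<le> (s + 1)\<^sup>2" if "x \<in> set xs" for x
    using assms(4) that le by fastforce
  ultimately show ?thesis
    by (simp add: t state_def config_within_def)
qed

section \<open>Input encoding and total running time\<close>

definition item_code :: "(nat \<Rightarrow> nat \<Rightarrow> rat) \<Rightarrow> nat \<Rightarrow> int list" where
  "item_code u j =
     (case (quotient_of (u 1 j), quotient_of (u 2 j)) of ((a, b), (c, d)) \<Rightarrow> [a, b, c, d])"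

lemma item_code_eq:
  "quotient_of (u 1 j) = (a, b) \<Longrightarrow> quotient_of (u 2 j) = (c, d) \<Longrightarrow> item_code u j = [a, b, c, d]"
  by (simp add: item_code_def)

text \<open>The part of the input still unread after \<open>k\<close> of the \<open>m\<close>
  items.\<close>

definition items_code :: "(nat \<Rightarrow> nat \<Rightarrow> rat) \<Rightarrow> nat \<Rightarrow> nat \<Rightarrow> int list" where
  "items_code u k m = concat (map (item_code u) [Suc k..<Suc m])"

lemma encode_2: "encode (2, m, u) = 2 # int m # items_code u 0 m"
  by (simp add: encode_def items_code_def item_code_def[abs_def] numeral_2_eq_2 prod.case_eq_if)

lemma input_size_append: "input_size (xs @ ys) = input_size xs + input_size ys"
  by (simp add: input_size_def)

lemma int_len_le_input_size: "x \<in> set xs \<Longrightarrow> int_len x \<le> input_size xs"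
  unfolding input_size_def by (intro member_le_sum_list) auto

lemma items_code_Suc: "k < m \<Longrightarrow> items_code u k m = item_code u (Suc k) @ items_code u (Suc k) m"
  unfolding items_code_def by (subst upt_conv_Cons) simp_all

lemma items_code_extend: "items_code u 0 (Suc k) = items_code u 0 k @ item_code u (Suc k)"
  by (simp add: items_code_def)

lemma tally_within_input_size:
  "tally_within (input_size (items_code u 0 k)) (tally (u 1) (u 2) k)"
  "tally_within (input_size (items_code u 0 k)) (tally (u 2) (u 1) k)"
proof (induction k)
  case 0
  show "tally_within (input_size (items_code u 0 0)) (tally (u 1) (u 2) 0)"
    "tally_within (input_size (items_code u 0 0)) (tally (u 2) (u 1) 0)"
    by (simp_all add: int_len_le_iff items_code_def input_size_def)
next
  case (Suc k)
  obtain a b where q: "quotient_of (u 1 (Suc k)) = (a, b)"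
    by fastforce
  obtain c d where q': "quotient_of (u 2 (Suc k)) = (c, d)"
    by fastforce
  have size: "input_size (items_code u 0 (Suc k)) =
      input_size (items_code u 0 k) + int_len a + int_len b + int_len c + int_len d"
    by (simp add: items_code_extend input_size_append item_code_eq[of u, OF q q']) (simp add: input_size_def)
  show "tally_within (input_size (items_code u 0 (Suc k))) (tally (u 1) (u 2) (Suc k))"
    "tally_within (input_size (items_code u 0 (Suc k))) (tally (u 2) (u 1) (Suc k))"
    using tally_item_within[OF Suc(1)] tally_item_within[OF Suc(2)] size
    by (simp_all add: q[simplified] q')
qed

text \<open>Four bits suffice: register numbers are at most 15 and constants are 0 or 1.\<close>

lemma decider_within: "\<forall>i\<in>set decider. instr_within 4 i"
  by (simp add: decider_def agent_code_def verdict_code_def int_len_le_iff)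

lemma input_size_encode:
  "1 + int_len (int m) + input_size (items_code u 0 m) \<le> input_size (encode (2, m, u))"
  unfolding encode_2 using int_len_ge_1[of 2] by (simp add: input_size_def)

text \<open>The number of iterations is linear in the input size although \<open>m\<close> is
  written in binary, since each item occupies at least one bit.\<close>

lemma le_input_size_items_code: "m \<le> input_size (items_code u 0 m)"
proof (induction m)
  case (Suc m)
  have "item_code u (Suc m) \<noteq> []"
    by (simp add: item_code_def split: prod.splits)
  then obtain x where "x \<in> set (item_code u (Suc m))"
    by (meson last_in_set)
  then have "1 \<le> input_size (item_code u (Suc m))"
    using int_len_le_input_size int_len_ge_1 order_trans by blast
  then show ?case
    using Suc by (simp add: items_code_extend input_size_append)
qed simp

text \<open>At every loop head all numbers have length at most \<open>(s + 1)\<^sup>2\<close>, so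
  the doubling per step starts afresh in each iteration and costs only the constant factor 2 ^
  76.\<close>

lemma halts_loop:
  assumes "k \<le> m"
    and s: "input_size (encode (2, m, u)) = s"
  shows "\<exists>t. halts_in decider
      (loop_state (int m - int k) (tally (u 1) (u 2) k) (tally (u 2) (u 1) k) (items_code u k m)) t
      [if tally_ok (tally (u 1) (u 2) m) \<and> tally_ok (tally (u 2) (u 1) m) then 1 else 0] \<and>
    t \<le> 4 * 2 ^ 76 * (s + 1)\<^sup>2 * (m - k + 1) + 1"
proof -
  let ?c = "\<lambda>k. loop_state (int m - int k) (tally (u 1) (u 2) k) (tally (u 2) (u 1) k) (items_code u k m)"
  let ?ys = "[if tally_ok (tally (u 1) (u 2) m) \<and> tally_ok (tally (u 2) (u 1) m) then 1 else 0]"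
  define w where "w = (s + 1)\<^sup>2"
  define K where "K = (4 * 2 ^ 76 :: nat)"
  have K: "4 * 2 ^ n * w \<le> K * w" if "n \<le> 76" for n
    unfolding K_def using that by (intro mult_right_mono mult_left_mono power_increasing) auto
  note s_ge = input_size_encode[of m u, unfolded s]
  have split: "items_code u 0 m = items_code u 0 k @ items_code u k m" if "k \<le> m" for k
    unfolding items_code_def using that
    using upt_add_eq_append[of "Suc 0" "Suc k" "m - k"] by simp
  have within: "config_within w (?c k)" if "k \<le> m" for k
    unfolding w_def
  proof (rule config_within_loop_state)
    have "input_size (items_code u 0 k) \<le> s"
      using split[OF that] s_ge by (simp add: input_size_append)
    then show "tally_within s (tally (u 1) (u 2) k)" "tally_within s (tally (u 2) (u 1) k)"
      using tally_within_input_size tally_within_mono by blast+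
    have "\<bar>int m - int k\<bar> \<le> \<bar>int m\<bar>"
      using that by simp
    then have "int_len (int m - int k) \<le> int_len (int m)"
      using abs_less_int_len[of "int m"] int_len_ge_1[of "int m"] unfolding int_len_le_iff
      by linarith
    then show "int_len (int m - int k) \<le> s"
      using s_ge by simp
    show "\<forall>x\<in>set (items_code u k m). int_len x \<le> s"
      using int_len_le_input_size[of _ "items_code u 0 m"] split[OF that] s_ge by fastforce
  qed
  have "4 \<le> w"
    using s_ge power_mono[of 2 "s + 1" 2] by (simp add: w_def)
  then have code: "\<forall>i\<in>set decider. instr_within w i"
    using decider_within instr_within_mono by blast
  show ?thesis
    unfolding w_def[symmetric] K_def[symmetric] using \<open>k \<le> m\<close>
  \<comment> \<open>Induction runs backwards from \<open>k = m\<close>, as \<open>halts_in\<close>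
    is built up from the halting end.\<close>
  proof (induction k rule: inc_induct)
    case base
    obtain n c where n: "n \<le> 21" "run decider n (?c m) = Some c" "pc c < length decider"
      "decider ! pc c = Halt" "outp c = ?ys"
      using run_verdict[of "tally (u 1) (u 2) m" "tally (u 2) (u 1) m" "items_code u m m"] by auto
    have "halts_in decider c 1 ?ys"
      using halts_in.halt[OF n(3,4)] n(5) by simp
    from halts_in_run[OF n(2) this code within[OF order_refl]]
    obtain t where "halts_in decider (?c m) t ?ys" "t + 4 * w \<le> 4 * 2 ^ n * w + 1"
      by blast
    moreover have "4 * 2 ^ n * w \<le> K * w"
      using K n(1) by simp
    ultimately have "t \<le> K * w + 1"
      by linarith
    with \<open>halts_in decider (?c m) t ?ys\<close> show ?case
      by (intro exI[of _ t]) simp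
  next
    case (step k)
    obtain a b c d where q: "quotient_of (u 1 (Suc k)) = (a, b)" "quotient_of (u 2 (Suc k)) = (c, d)"
      by (metis surj_pair)
    have "items_code u k m = a # b # c # d # items_code u (Suc k) m"
      using items_code_Suc[OF step(2)] item_code_eq[of u, OF q] by simp
    then obtain n where n: "n \<le> 76" "run decider n (?c k) = Some (?c (Suc k))"
      using run_item[of "int m - int k" "tally (u 1) (u 2) k" "tally (u 2) (u 1) k" a b c d] step(2)
      by (auto simp: q[simplified] diff_diff_eq algebra_simps)
    obtain t where t: "halts_in decider (?c (Suc k)) t ?ys"
      "t \<le> K * w * (m - Suc k + 1) + 1"
      using step.IH by blast
    obtain t' where "halts_in decider (?c k) t' ?ys" "t' + 4 * w \<le> 4 * 2 ^ n * w + t"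
      using halts_in_run[OF n(2) t(1) code within] step(2) by auto
    moreover have "4 * 2 ^ n * w \<le> K * w"
      using K n(1) by blast
    moreover have "K * w * (m - k + 1) = K * w * (m - Suc k + 1) + K * w"
      using step(2) by (simp add: Suc_diff_Suc algebra_simps)
    ultimately show ?case
      using t(2) by (intro exI[of _ t'] conjI) linarith+
  qed
qed

lemma halts_decider:
  fixes m u
  defines "s \<equiv> input_size (encode (2, m, u))"
  shows "\<exists>t. halts_in decider (initial (encode (2, m, u))) t
      [if tally_ok (tally (u 1) (u 2) m) \<and> tally_ok (tally (u 2) (u 1) m) then 1 else 0] \<and>
    t \<le> 4 * 2 ^ 76 * (s + 1) ^ 3 + 1"
proof -
  let ?ys = "[if tally_ok (tally (u 1) (u 2) m) \<and> tally_ok (tally (u 2) (u 1) m) then 1 else 0]"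
  define w where "w = (s + 1)\<^sup>2"
  define K where "K = (4 * 2 ^ 76 :: nat)"
  have K: "4 * 2 ^ 8 * w \<le> K * w"
    by (simp add: K_def)
  have "m + 1 \<le> s"
    using input_size_encode[of m u] le_input_size_items_code[of m u] by (simp add: s_def)
  have "s \<le> w"
    by (simp add: w_def power2_eq_square)
  moreover have "4 \<le> w"
    using \<open>m + 1 \<le> s\<close> power_mono[of 2 "s + 1" 2] by (simp add: w_def)
  moreover have "int_len 0 = 1"
    by (simp add: int_len_def floorlog_def)
  ultimately have within: "config_within w (initial (encode (2, m, u)))"
    using int_len_le_input_size[of _ "encode (2, m, u)"]
    by (auto simp: config_within_def initial_def s_def intro: order_trans)
  have code: "\<forall>i\<in>set decider. instr_within w i"
    using decider_within instr_within_mono \<open>4 \<le> w\<close> by blast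
  obtain t where t: "halts_in decider
      (loop_state (int m) (tally (u 1) (u 2) 0) (tally (u 2) (u 1) 0) (items_code u 0 m)) t ?ys"
    "t \<le> K * w * (m + 1) + 1"
    using halts_loop[of 0 m u s] by (auto simp: s_def w_def K_def)
  have "run decider 8 (initial (encode (2, m, u))) =
      Some (loop_state (int m) (tally (u 1) (u 2) 0) (tally (u 2) (u 1) 0) (items_code u 0 m))"
    unfolding encode_2 by (simp only: run_init tally.simps One_nat_def)
  from halts_in_run[OF this t(1) code within]
  obtain t' where t': "halts_in decider (initial (encode (2, m, u))) t' ?ys"
    "t' + 4 * w \<le> 4 * 2 ^ 8 * w + t"
    by blast
  have "t' \<le> K * w + (K * w * (m + 1) + 1)"
    using t'(2) t(2) K by linarith
  also have "\<dots> = K * w * (m + 2) + 1"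
    by simp
  \<comment> \<open>Of the \<open>m + 2\<close> blocks, one is the initialization, \<open>m\<close>
    are the items and one is the verdict.\<close>
  also have "\<dots> \<le> K * w * (s + 1) + 1"
    using \<open>m + 1 \<le> s\<close> by (intro add_right_mono mult_left_mono) auto
  also have "\<dots> = K * (s + 1) ^ 3 + 1"
    by (simp only: w_def power2_eq_square power3_eq_cube mult.assoc)
  finally show ?thesis
    using t'(1) unfolding K_def by blast
qed

theorem theorem6p2:
  shows "decidable_in_polynomial_time (instances_with_agents 2) encode ExistsUMandPROP1"
  unfolding decidable_in_polynomial_time_def
\<comment> \<open>With \<open>[:1, 1:]\<close> denoting X + 1, the time bound is 1 + 4 * 2 ^ 76 * (X
  + 1) ^ 3.\<close>
proof (intro exI[of _ decider] exI[of _ "[:1:] + [:4 * 2 ^ 76:] * [:1, 1:] ^ 3"] ballI)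
  fix x :: rat_instance
  assume "x \<in> instances_with_agents 2"
  then obtain m u where x: "x = (2, m, u)" "allocation_instance 2 m u"
    by (auto simp: instances_with_agents_def)
  have "ExistsUMandPROP1 x \<longleftrightarrow> tally_ok (tally (u 1) (u 2) m) \<and> tally_ok (tally (u 2) (u 1) m)"
    using exists_UM_and_PROP1_2_iff[OF x(2)] by (simp add: ExistsUMandPROP1_def x(1) tally_ok_iff)
  moreover have "poly ([:1:] + [:4 * 2 ^ 76:] * [:1, 1:] ^ 3) s = 4 * 2 ^ 76 * (s + 1) ^ 3 + 1" for s :: nat
    by (simp add: poly_power)
  ultimately show "\<exists>t. halts_in decider (initial (encode x)) t [if ExistsUMandPROP1 x then 1 else 0] \<and>
      t \<le> poly ([:1:] + [:4 * 2 ^ 76:] * [:1, 1:] ^ 3) (input_size (encode x))"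
    using halts_decider[of m u] unfolding x(1) by (simp only:)
qed

end
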